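(* Let $d\ge2$, let $\mathcal C=h\mathcal O^d$ be a convex body in $\tilde{\mathcal K}^d$ with $h\in\mathrm{GL}_d(\tilde{\mathcal K})$, and let $\Lambda=g\mathcal R^d$ be a lattice with $g\in\mathrm{GL}_d(\tilde{\mathcal K})$. Then $$\operatorname{CovRad}_{\mathcal C}(\Lambda)=\frac1q\lambda_d\left(h^{-1}\Lambda\right)=\frac1q\lambda_d\left(h^{-1}g\mathcal R^d\right).$$
   Context: Let $q$ be a prime power, $\mathcal R=\mathbb F_q[x]$, and $\tilde{\mathcal K}=\mathbb F_q((x^{-1}))$, with the absolute value $|\cdot|$ extending $|f|=q^{\deg f}$ for nonzero $f\in\mathcal R$ (and $|0|=0$); $\mathcal O=\mathbb F_q[[x^{-1}]]=\{f\in\tilde{\mathcal K}:|f|\le1\}$. On $\tilde{\mathcal K}^d$ use the norm $\|\mathbf v\|=\max_i|v_i|$. A lattice in $\tilde{\mathcal K}^d$ is a set $g\mathcal R^d$ with $g\in\mathrm{GL}_d(\tilde{\mathcal K})$; its $i$-th successive minimum is $\lambda_i(\Lambda)=\min\{r>0:\text{ there exist } i \text{ linearly independent vectors in }\Lambda\text{ of norm}\le r\}$. A convex body is a set of the form $\mathcal C=h\mathcal O^d$ with $h\in\mathrm{GL}_d(\tilde{\mathcal K})$. For real $r>0$, $r\mathcal C=h\{\mathbf w\in\tilde{\mathcal K}^d:\|\mathbf w\|\le r\}$, and $\operatorname{CovRad}_{\mathcal C}(\Lambda)$ is the smallest $r>0$ such that $\Lambda+r\mathcal C=\tilde{\mathcal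 K}^d$. *)

theory Defs
  imports "HOL-Analysis.Analysis" "HOL-Computational_Algebra.Formal_Laurent_Series"
begin

text \<open>
  \<open>\<F>\<^sub>q\<close> is a type \<open>'a :: {field, finite}\<close> with \<open>q = CARD('a)\<close>, and \<open>\<F>\<^sub>q((x\<^sup>-\<^sup>1))\<close> is \<open>'a fls\<close>, whose
  formal variable \<open>fls_X\<close> plays the role of \<open>x\<^sup>-\<^sup>1\<close>; so \<open>x\<close> itself is \<open>fls_X_inv\<close>. The dimension
  \<open>d\<close> is \<open>CARD('n)\<close>.
\<close>

definition poly_to_laurent :: "'a::field poly \<Rightarrow> 'a fls" where
  "poly_to_laurent p = poly (map_poly fls_const p) fls_X_inv"

definition laurent_abs :: "'a::{field,finite} fls \<Rightarrow> real" where
  "laurent_abs f = (if f = 0 then 0 else real CARD('a) powi (- fls_subdegree f))"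

definition vec_norm :: "'a::{field,finite} fls ^ 'n \<Rightarrow> real" where
  "vec_norm v = Max (range (\<lambda>i. laurent_abs (v $ i)))"

definition poly_vectors :: "('a::{field,finite} fls ^ 'n) set" where
  "poly_vectors = {v. \<forall>i. v $ i \<in> range poly_to_laurent}"

definition integral_vectors :: "('a::{field,finite} fls ^ 'n) set" where
  "integral_vectors = {v. \<forall>i. laurent_abs (v $ i) \<le> 1}"

text \<open>
  The value does not depend on the matrix \<open>h\<close> representing the body: see \<open>dilate_eq\<close> below.
\<close>

definition dilate :: "real \<Rightarrow> ('a::{field,finite} fls ^ 'n) set \<Rightarrow> ('a fls ^ 'n) set" where
  "dilate r C = {h *v w | (h :: 'a fls ^ 'n ^ 'n) w. invertible h \<and>
                   C = (*v) h ` integral_vectors \<and> vec_norm w \<le> r}"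

definition successive_minimum :: "nat \<Rightarrow> ('a::{field,finite} fls ^ 'n) set \<Rightarrow> real" where
  "successive_minimum i \<Lambda> =
     (LEAST r. r > 0 \<and>
        (\<exists>S \<subseteq> \<Lambda>. finite S \<and> card S = i \<and> vec.independent S \<and> (\<forall>v\<in>S. vec_norm v \<le> r)))"

definition covering_radius ::
  "('a::{field,finite} fls ^ 'n) set \<Rightarrow> ('a fls ^ 'n) set \<Rightarrow> real" where
  "covering_radius C \<Lambda> =
     (LEAST r. r > 0 \<and> {u + v | u v. u \<in> \<Lambda> \<and> v \<in> dilate r C} = UNIV)"

lemma card_field_gt_1: "CARD('a::{field,finite}) > 1"
proof -
  have "card {0, 1 :: 'a} \<le> CARD('a)" by (intro card_mono) auto
  thus ?thesis by simp
qed

lemma laurent_abs_pos_iff: "laurent_abs f > 0 \<longleftrightarrow> f \<noteq> 0"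
  by (simp add: laurent_abs_def)

lemma laurent_abs_le_powi_iff:
  fixes f :: "'a::{field,finite} fls"
  shows "laurent_abs f \<le> real CARD('a) powi k \<longleftrightarrow> (\<forall>n < -k. fls_nth f n = 0)"
proof (cases "f = 0")
  case False
  have "laurent_abs f \<le> real CARD('a) powi k \<longleftrightarrow> - fls_subdegree f \<le> k"
    using card_field_gt_1[where 'a = 'a] False
      power_int_strict_increasing[of k "- fls_subdegree f" "real CARD('a)"]
      power_int_increasing[of "- fls_subdegree f" k "real CARD('a)"]
    by (force simp: laurent_abs_def)
  also have "\<dots> \<longleftrightarrow> (\<forall>n < -k. fls_nth f n = 0)"
    using False nth_fls_subdegree_nonzero[of f] fls_subdegree_geI[of f "-k"]
    by (force intro: fls_eq0_below_subdegree)
  finally show ?thesis .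
qed (simp add: laurent_abs_def)

lemma laurent_abs_mult: "laurent_abs (f * g) = laurent_abs f * laurent_abs g"
  by (simp add: laurent_abs_def power_int_add power_int_diff power_int_minus field_simps)

lemma poly_to_laurent_nth:
  "fls_nth (poly_to_laurent p) n = (if n \<le> 0 then coeff p (nat (- n)) else 0)"
proof (induction p arbitrary: n)
  case 0
  show ?case by (simp add: poly_to_laurent_def)
next
  case (pCons a p)
  have "poly_to_laurent (pCons a p) = fls_const a + fls_X_inv * poly_to_laurent p"
    using pCons(1) by (simp add: poly_to_laurent_def map_poly_pCons)
  hence "fls_nth (poly_to_laurent (pCons a p)) n =
           (if n = 0 then a else 0) + fls_nth (poly_to_laurent p) (n + 1)"
    by (simp add: fls_X_inv_times_conv_shift)
  moreover have "nat (- n) = Suc (nat (- (n + 1)))" if "n < 0"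
    using that by simp
  ultimately show ?case
    using pCons.IH by (auto simp: coeff_pCons split: nat.splits)
qed

lemma laurent_abs_poly:
  fixes p :: "'a::{field,finite} poly"
  assumes "p \<noteq> 0"
  shows "laurent_abs (poly_to_laurent p) = real CARD('a) ^ degree p"
proof -
  have "fls_subdegree (poly_to_laurent p) = - int (degree p)"
    using assms by (intro fls_subdegree_eqI) (auto simp: poly_to_laurent_nth coeff_eq_0)
  moreover have "poly_to_laurent p \<noteq> 0"
  proof
    assume "poly_to_laurent p = 0"
    with assms poly_to_laurent_nth[of p "- int (degree p)"] show False by simp
  qed
  ultimately show ?thesis by (simp add: laurent_abs_def)
qed

lemma vec_norm_le_iff: "vec_norm v \<le> r \<longleftrightarrow> (\<forall>i. laurent_abs (v $ i) \<le> r)"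
  by (simp add: vec_norm_def)

lemma integral_vectors_eq: "integral_vectors = {v. vec_norm v \<le> 1}"
  by (auto simp: integral_vectors_def vec_norm_le_iff)

lemma vec_norm_scale: "vec_norm (c *s v) = laurent_abs c * vec_norm v"
proof -
  have "mono ((*) (laurent_abs c))"
    by (intro monoI mult_left_mono) (auto simp: laurent_abs_def)
  hence "laurent_abs c * vec_norm v = Max ((*) (laurent_abs c) ` range (\<lambda>i. laurent_abs (v $ i)))"
    unfolding vec_norm_def by (rule mono_Max_commute) auto
  also have "\<dots> = vec_norm (c *s v)"
    by (simp add: vec_norm_def laurent_abs_mult image_image)
  finally show ?thesis ..
qed

lemma dilate_eq:
  fixes h :: "'a::{field,finite} fls ^ 'n ^ 'n"
  assumes "invertible h"
  shows "dilate r ((*v) h ` integral_vectors) = (*v) h ` {w. vec_norm w \<le> r}"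
proof (intro equalityI subsetI)
  fix v assume "v \<in> dilate r ((*v) h ` integral_vectors)"
  then obtain h' :: "'a fls ^ 'n ^ 'n" and w
    where eq: "(*v) h ` integral_vectors = (*v) h' ` integral_vectors"
      and w: "vec_norm w \<le> r" and v: "v = h' *v w"
    by (auto simp: dilate_def)
  have "vec_norm w \<in> range (\<lambda>i. laurent_abs (w $ i))"
    unfolding vec_norm_def by (intro Max_in) auto
  then obtain i where i: "vec_norm w = laurent_abs (w $ i)" by auto
  show "v \<in> (*v) h ` {w. vec_norm w \<le> r}"
  proof (cases "w $ i = 0")
    case True
    hence "laurent_abs (w $ j) \<le> 0" for j
      using i vec_norm_le_iff[of w "vec_norm w"] by (simp add: laurent_abs_def)
    hence "w $ j = 0" for j
      by (simp add: laurent_abs_pos_iff flip: not_less)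
    hence "w = 0" by (simp add: vec_eq_iff)
    thus ?thesis using w v by (intro image_eqI[of _ _ 0]) auto
  next
    case False
    define c where "c = w $ i"
    define w0 where "w0 = inverse c *s w"
    have c: "c \<noteq> 0" and w0: "w = c *s w0"
      using False by (auto simp: c_def w0_def)
    have "laurent_abs c > 0"
      using c by (simp add: laurent_abs_pos_iff)
    moreover have "vec_norm w = laurent_abs c * vec_norm w0"
      using vec_norm_scale[of c w0] by (simp add: w0)
    ultimately have "vec_norm w0 = 1" using i by (simp add: c_def)
    hence "h' *v w0 \<in> (*v) h ` integral_vectors"
      unfolding eq by (auto simp: integral_vectors_eq)
    then obtain u where u: "vec_norm u \<le> 1" "h' *v w0 = h *v u"
      by (auto simp: integral_vectors_eq)
    have "v = h *v (c *s u)"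
      by (simp add: v w0 u(2) vec.scale)
    moreover have "vec_norm (c *s u) \<le> r"
    proof -
      have "laurent_abs c * vec_norm u \<le> laurent_abs c * 1"
        using u(1) \<open>laurent_abs c > 0\<close> by (intro mult_left_mono) auto
      thus ?thesis using i w by (simp add: vec_norm_scale c_def)
    qed
    ultimately show ?thesis by auto
  qed
next
  fix v assume "v \<in> (*v) h ` {w. vec_norm w \<le> r}"
  thus "v \<in> dilate r ((*v) h ` integral_vectors)"
    using assms by (auto simp: dilate_def)
qed

end

theory Submission
  imports Defs
begin

text \<open>
  Put \<open>L = h\<^sup>-\<^sup>1\<Lambda>\<close>. Applying \<open>h\<^sup>-\<^sup>1\<close> turns a covering of the space by \<open>\<Lambda> + r C\<close> into a covering by
  \<open>L\<close> plus the ball of radius \<open>r\<close>, so everything reduces to one equivalence for \<open>r > 0\<close>: the balls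
  of radius \<open>r\<close> around \<open>L\<close> cover the space if and only if \<open>L\<close> contains \<open>d\<close> independent vectors of
  norm at most \<open>q r\<close>.

  If such vectors \<open>v\<^sub>1, \<dots>, v\<^sub>d\<close> exist, an arbitrary vector is \<open>\<Sum> c\<^sub>i v\<^sub>i\<close>. Each \<open>c\<^sub>i\<close> is a polynomial
  plus a remainder of absolute value at most \<open>1/q\<close>; the polynomial parts give a point of \<open>L\<close>, and
  by the ultrametric inequality the remainders contribute norm at most \<open>r\<close>
  (\<open>cover_if_short_basis\<close>).

  Conversely, suppose that the balls of radius \<open>r\<close> cover, and let \<open>W\<close> be the span of the vectors of
  \<open>L\<close> of norm at most \<open>q r\<close>. A longer \<open>u \<in> L\<close> is divided by \<open>x\<close> and rounded to some \<open>u' \<in> L\<close> with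
  \<open>\<parallel>u/x - u'\<parallel> \<le> r\<close>. Then \<open>u - x u'\<close> is in \<open>L\<close> and has norm at most \<open>q r\<close>, while \<open>u'\<close> is shorter
  than \<open>u\<close> by a factor of at least \<open>q\<close>. Descending in this way yields \<open>u \<in> W\<close>, so \<open>W\<close> contains \<open>L\<close> and is the
  whole space (\<open>short_basis_if_cover\<close>). This replaces reduction theory for \<open>L\<close> by a
  Euclidean division.

  The equivalence says that the admissible radii are the admissible bounds for the last minimum,
  divided by \<open>q\<close>. To compare least elements it remains to see that a least bound exists: norms are
  powers of \<open>q\<close>, and nonzero vectors of \<open>L\<close> have norm bounded away from \<open>0\<close>
  (\<open>least_short_basis_bound\<close>).
\<close>

section \<open>The ultrametric norm\<close>

lemma laurent_abs_nonneg: "laurent_abs f \<ge> 0"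
  by (simp add: laurent_abs_def)

lemma laurent_abs_eq_powi:
  fixes f :: "'a::{field,finite} fls"
  shows "f \<noteq> 0 \<Longrightarrow> \<exists>k. laurent_abs f = real CARD('a) powi k"
  by (auto simp: laurent_abs_def)

lemma laurent_abs_uminus: "laurent_abs (- f) = laurent_abs f"
  by (simp add: laurent_abs_def)

lemma laurent_abs_add:
  fixes f g :: "'a::{field,finite} fls"
  assumes "laurent_abs f \<le> r" "laurent_abs g \<le> r"
  shows "laurent_abs (f + g) \<le> r"
proof -
  have *: "laurent_abs (f + g) \<le> laurent_abs g"
    if le: "laurent_abs f \<le> laurent_abs g" and g: "g \<noteq> 0" for f g :: "'a fls"
  proof -
    obtain k where k: "laurent_abs g = real CARD('a) powi k"
      using laurent_abs_eq_powi[OF g] by auto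
    have "\<forall>n < -k. fls_nth f n = 0" "\<forall>n < -k. fls_nth g n = 0"
      using le k laurent_abs_le_powi_iff[of f k] laurent_abs_le_powi_iff[of g k] by auto
    thus ?thesis unfolding k laurent_abs_le_powi_iff by simp
  qed
  show ?thesis
  proof (cases "f = 0 \<or> g = 0")
    case True
    thus ?thesis using assms by auto
  next
    case False
    thus ?thesis
      using assms *[of f g] *[of g f]
      by (cases "laurent_abs f \<le> laurent_abs g") (auto simp: add.commute)
  qed
qed

lemma laurent_abs_X_inv: "laurent_abs (fls_X_inv :: 'a::{field,finite} fls) = real CARD('a)"
  by (simp add: laurent_abs_def)

lemma vec_norm_attained:
  fixes v :: "'a::{field,finite} fls ^ 'n"
  obtains i where "vec_norm v = laurent_abs (v $ i)"
proof -
  have "vec_norm v \<in> range (\<lambda>i. laurent_abs (v $ i))"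
    unfolding vec_norm_def by (intro Max_in) auto
  thus ?thesis using that by auto
qed

lemma component_le_vec_norm: "laurent_abs (v $ i) \<le> vec_norm v"
  using vec_norm_le_iff[of v "vec_norm v"] by simp

lemma vec_norm_nonneg: "vec_norm v \<ge> 0"
  using component_le_vec_norm laurent_abs_nonneg order_trans by blast

lemma vec_norm_pos:
  assumes "v \<noteq> 0"
  shows "vec_norm v > 0"
proof -
  obtain i where "v $ i \<noteq> 0" using assms by (auto simp: vec_eq_iff)
  thus ?thesis
    using component_le_vec_norm[of v i] laurent_abs_pos_iff[of "v $ i"] by linarith
qed

lemma vec_norm_eq_powi:
  fixes v :: "'a::{field,finite} fls ^ 'n"
  assumes "v \<noteq> 0"
  shows "\<exists>k. vec_norm v = real CARD('a) powi k"
proof -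
  obtain i where i: "vec_norm v = laurent_abs (v $ i)" by (rule vec_norm_attained)
  hence "v $ i \<noteq> 0" using vec_norm_pos[OF assms] laurent_abs_pos_iff by metis
  thus ?thesis unfolding i by (rule laurent_abs_eq_powi)
qed

lemma vec_norm_add: "vec_norm u \<le> r \<Longrightarrow> vec_norm v \<le> r \<Longrightarrow> vec_norm (u + v) \<le> r"
  by (auto simp: vec_norm_le_iff intro: laurent_abs_add)

lemma vec_norm_uminus: "vec_norm (- v) = vec_norm v"
  by (simp add: vec_norm_def laurent_abs_uminus)

lemma vec_norm_diff: "vec_norm u \<le> r \<Longrightarrow> vec_norm v \<le> r \<Longrightarrow> vec_norm (u - v) \<le> r"
  using vec_norm_add[of u r "- v"] by (simp add: vec_norm_uminus)

lemma vec_norm_sum: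
  assumes "r \<ge> 0" "\<And>i. i \<in> I \<Longrightarrow> vec_norm (f i) \<le> r"
  shows "vec_norm (sum f I) \<le> r"
proof -
  have zero: "vec_norm 0 \<le> r"
    using assms(1) by (simp add: vec_norm_le_iff laurent_abs_def)
  show ?thesis
    using assms(2) by (induction I rule: infinite_finite_induct) (auto simp: zero vec_norm_add)
qed

lemma vec_norm_matrix_bound:
  fixes A :: "'a::{field,finite} fls ^ 'n ^ 'm"
  obtains b where "b > 0" "\<And>v. vec_norm (A *v v) \<le> b * vec_norm v"
proof -
  define b where "b = 1 + (\<Sum>j\<in>UNIV. vec_norm (column j A))"
  have col: "vec_norm (column j A) \<le> b" for j
    using member_le_sum[of j UNIV "\<lambda>j. vec_norm (column j A)"]
    by (simp add: b_def vec_norm_nonneg)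
  have "b > 0"
    unfolding b_def by (intro add_pos_nonneg sum_nonneg) (auto simp: vec_norm_nonneg)
  moreover have "vec_norm (A *v v) \<le> b * vec_norm v" for v
    unfolding matrix_mult_sum
  proof (rule vec_norm_sum)
    show "0 \<le> b * vec_norm v"
      using \<open>b > 0\<close> by (simp add: vec_norm_nonneg)
    fix j
    have "laurent_abs (v $ j) * vec_norm (column j A) \<le> vec_norm v * b"
      by (intro mult_mono component_le_vec_norm col vec_norm_nonneg)
    thus "vec_norm (v $ j *s column j A) \<le> b * vec_norm v"
      by (simp add: vec_norm_scale mult.commute)
  qed
  ultimately show ?thesis by (rule that)
qed

section \<open>Polynomials inside the Laurent series\<close>

lemma poly_to_laurent_0: "poly_to_laurent 0 = 0"
  by (simp add: poly_to_laurent_def)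

lemma poly_to_laurent_1: "poly_to_laurent 1 = 1"
  by (simp add: poly_to_laurent_def)

lemma zero_one_in_range_poly_to_laurent:
  "0 \<in> range poly_to_laurent" "1 \<in> range poly_to_laurent"
  by (metis rangeI poly_to_laurent_0) (metis rangeI poly_to_laurent_1)

lemma poly_to_laurent_X: "poly_to_laurent [:0, 1:] = fls_X_inv"
  by (simp add: poly_to_laurent_def map_poly_pCons)

lemma poly_to_laurent_add: "poly_to_laurent (p + q) = poly_to_laurent p + poly_to_laurent q"
  by (rule fls_eqI) (simp add: poly_to_laurent_nth)

lemma poly_to_laurent_smult: "poly_to_laurent (smult a p) = fls_const a * poly_to_laurent p"
  by (rule fls_eqI) (simp add: poly_to_laurent_nth)

lemma poly_to_laurent_pCons:
  "poly_to_laurent (pCons a p) = fls_const a + fls_X_inv * poly_to_laurent p"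
  by (cases "a = 0 \<and> p = 0") (auto simp: poly_to_laurent_def map_poly_pCons)

lemma poly_to_laurent_mult: "poly_to_laurent (p * q) = poly_to_laurent p * poly_to_laurent q"
  by (induction p)
    (simp_all add: poly_to_laurent_0 poly_to_laurent_add poly_to_laurent_smult
      poly_to_laurent_pCons algebra_simps)

text \<open>
  The terms of nonpositive order in \<open>x\<^sup>-\<^sup>1\<close> form a polynomial in \<open>x\<close>; what remains starts at order
  \<open>1\<close>. This gap between \<open>1\<close> and \<open>1/q\<close> in the value group is where the factor \<open>1/q\<close> of the
  covering radius comes from.
\<close>

lemma laurent_polynomial_part:
  fixes f :: "'a::{field,finite} fls"
  obtains p where "laurent_abs (f - poly_to_laurent p) \<le> 1 / real CARD('a)"
proof -
  define N where "N = nat (1 - fls_subdegree f)"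
  define p where "p = Poly (map (\<lambda>i. fls_nth f (- int i)) [0..<N])"
  have "fls_nth f (- int i) = 0" if "i \<ge> N" for i
    using that by (intro fls_eq0_below_subdegree) (simp add: N_def)
  hence "coeff p i = fls_nth f (- int i)" for i
    by (auto simp: p_def coeff_Poly_eq nth_default_def)
  hence "\<forall>n < - (- 1). fls_nth (f - poly_to_laurent p) n = 0"
    by (simp add: poly_to_laurent_nth)
  hence "laurent_abs (f - poly_to_laurent p) \<le> real CARD('a) powi (- 1)"
    by (subst laurent_abs_le_powi_iff)
  thus ?thesis by (intro that[of p]) (simp add: power_int_minus field_simps)
qed

lemma vec_norm_poly_vectors_ge_1:
  fixes v :: "'a::{field,finite} fls ^ 'n"
  assumes "v \<in> poly_vectors" "v \<noteq> 0"
  shows "vec_norm v \<ge> 1"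
proof -
  obtain i where i: "v $ i \<noteq> 0" using assms(2) by (auto simp: vec_eq_iff)
  obtain p where p: "v $ i = poly_to_laurent p" using assms(1) by (auto simp: poly_vectors_def)
  have "p \<noteq> 0" using i p by (auto simp: poly_to_laurent_0)
  hence "1 \<le> laurent_abs (v $ i)"
    unfolding p using card_field_gt_1[where 'a = 'a] by (simp add: laurent_abs_poly)
  thus ?thesis using component_le_vec_norm order_trans by blast
qed

definition poly_submodule :: "('a::{field,finite} fls ^ 'n) set \<Rightarrow> bool" where
  "poly_submodule L \<longleftrightarrow> 0 \<in> L \<and> (\<forall>u\<in>L. \<forall>v\<in>L. u + v \<in> L) \<and>
     (\<forall>p. \<forall>v\<in>L. poly_to_laurent p *s v \<in> L)"

lemma poly_submodule_sum:
  assumes "poly_submodule L" "\<And>i. i \<in> I \<Longrightarrow> f i \<in> L"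
  shows "sum f I \<in> L"
  using assms(2)
  by (induction I rule: infinite_finite_induct) (use assms(1) in \<open>auto simp: poly_submodule_def\<close>)

lemma poly_submodule_diff:
  assumes L: "poly_submodule L" and "u \<in> L" "v \<in> L"
  shows "u - v \<in> L"
proof -
  have "poly_to_laurent [:-1:] = (- 1 :: 'a fls)"
    by (rule fls_eqI) (simp add: poly_to_laurent_nth coeff_pCons split: nat.splits)
  hence "u + (- 1) *s v \<in> L"
    using assms unfolding poly_submodule_def by metis
  thus ?thesis by simp
qed

lemma poly_submodule_lattice:
  fixes A :: "'a::{field,finite} fls ^ 'n ^ 'm"
  shows "poly_submodule ((*v) A ` poly_vectors)"
  unfolding poly_submodule_def
proof (intro conjI ballI allI)
  show "0 \<in> (*v) A ` poly_vectors"
    by (rule image_eqI[of _ _ 0])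
      (auto simp: poly_vectors_def zero_one_in_range_poly_to_laurent)
next
  fix u v assume "u \<in> (*v) A ` poly_vectors" "v \<in> (*v) A ` poly_vectors"
  then obtain a b where ab: "u = A *v a" "v = A *v b" "a \<in> poly_vectors" "b \<in> poly_vectors"
    by auto
  have "a + b \<in> poly_vectors"
    using ab(3,4) by (auto simp: poly_vectors_def image_iff) (metis poly_to_laurent_add)
  thus "u + v \<in> (*v) A ` poly_vectors"
    by (rule image_eqI[rotated]) (simp add: ab vec.add)
next
  fix p v assume "v \<in> (*v) A ` poly_vectors"
  then obtain b where b: "v = A *v b" "b \<in> poly_vectors"
    by auto
  have "poly_to_laurent p *s b \<in> poly_vectors"
    using b(2) by (auto simp: poly_vectors_def image_iff) (metis poly_to_laurent_mult)
  thus "poly_to_laurent p *s v \<in> (*v) A ` poly_vectors"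
    by (rule image_eqI[rotated]) (simp add: b vec.scale)
qed

lemma span_poly_vectors: "vec.span (poly_vectors :: ('a::{field,finite} fls ^ 'n) set) = UNIV"
proof -
  have "cart_basis \<subseteq> (poly_vectors :: ('a fls ^ 'n) set)"
    by (auto simp: cart_basis_def poly_vectors_def axis_def zero_one_in_range_poly_to_laurent)
  thus ?thesis using vec.span_mono[of cart_basis] span_cart_basis by blast
qed

lemma span_lattice:
  fixes A :: "'a::{field,finite} fls ^ 'n ^ 'n"
  assumes "invertible A"
  shows "vec.span ((*v) A ` poly_vectors) = UNIV"
proof -
  have "surj ((*v) A)"
    using assms invertible_right_inverse matrix_right_invertible_surjective by blast
  thus ?thesis
    using vec.linear_span_image[OF matrix_vector_mul_linear_gen, of A poly_vectors]
    by (simp add: span_poly_vectors)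
qed

lemma spanning_set_contains_basis:
  fixes V :: "('a::field ^ 'n) set"
  assumes "vec.span V = UNIV"
  obtains S where "S \<subseteq> V" "finite S" "card S = CARD('n)" "vec.independent S"
proof -
  obtain S where S: "S \<subseteq> V" "vec.independent S" "card S = vec.dim V"
    using vec.basis_exists[of V] by metis
  have "vec.dim V = CARD('n)"
    using vec.dim_span[of V] by (simp add: assms vec_dim_card card_cart_basis)
  thus ?thesis using S by (intro that[of S]) (auto intro: vec.finiteI_independent)
qed

section \<open>Coverings and short bases\<close>

definition has_short_basis :: "('a::{field,finite} fls ^ 'n) set \<Rightarrow> real \<Rightarrow> bool" where
  "has_short_basis L s \<longleftrightarrow>
     (\<exists>S \<subseteq> L. finite S \<and> card S = CARD('n) \<and> vec.independent S \<and> (\<forall>v\<in>S. vec_norm v \<le> s))"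

definition covers_by_balls :: "('a::{field,finite} fls ^ 'n) set \<Rightarrow> real \<Rightarrow> bool" where
  "covers_by_balls L r \<longleftrightarrow> (\<forall>y. \<exists>u\<in>L. vec_norm (y - u) \<le> r)"

text \<open>Rounding the coordinates of a vector in a basis from \<open>L\<close> to polynomials rounds it to \<open>L\<close>.\<close>

lemma cover_if_short_basis:
  fixes L :: "('a::{field,finite} fls ^ 'n) set"
  assumes L: "poly_submodule L" and basis: "has_short_basis L (real CARD('a) * r)" and "r \<ge> 0"
  shows "covers_by_balls L r"
  unfolding covers_by_balls_def
proof
  fix y :: "'a fls ^ 'n"
  let ?q = "real CARD('a)"
  obtain S where S: "S \<subseteq> L" "finite S" "card S = CARD('n)" "vec.independent S"
    "\<forall>v\<in>S. vec_norm v \<le> ?q * r"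
    using basis by (auto simp: has_short_basis_def)
  have "UNIV \<subseteq> vec.span S"
    by (rule vec.card_ge_dim_independent) (use S in \<open>auto simp: vec_dim_card card_cart_basis\<close>)
  then obtain c where c: "y = (\<Sum>v\<in>S. c v *s v)"
    using vec.span_finite[OF S(2)] by auto
  have "\<forall>v. \<exists>p. laurent_abs (c v - poly_to_laurent p) \<le> 1 / ?q"
    using laurent_polynomial_part by metis
  then obtain p where p: "\<And>v. laurent_abs (c v - poly_to_laurent (p v)) \<le> 1 / ?q"
    by metis
  define u where "u = (\<Sum>v\<in>S. poly_to_laurent (p v) *s v)"
  have "u \<in> L"
    unfolding u_def using S(1) L
    by (intro poly_submodule_sum[OF L]) (auto simp: poly_submodule_def)
  moreover have "vec_norm (y - u) \<le> r"
  proof -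
    have "y - u = (\<Sum>v\<in>S. (c v - poly_to_laurent (p v)) *s v)"
      by (simp add: c u_def vec.scale_left_diff_distrib flip: sum_subtractf)
    moreover have "vec_norm ((c v - poly_to_laurent (p v)) *s v) \<le> r" if "v \<in> S" for v
    proof -
      have "laurent_abs (c v - poly_to_laurent (p v)) * vec_norm v \<le> 1 / ?q * (?q * r)"
        using S(5) that by (intro mult_mono p vec_norm_nonneg) auto
      thus ?thesis using card_field_gt_1[where 'a = 'a] by (simp only: vec_norm_scale) simp
    qed
    ultimately show ?thesis using \<open>r \<ge> 0\<close> by (simp add: vec_norm_sum)
  qed
  ultimately show "\<exists>u\<in>L. vec_norm (y - u) \<le> r" by blast
qed

text \<open>
  Euclidean division by \<open>x\<close> of a vector of norm above \<open>q r\<close>: the quotient, again in \<open>L\<close>, is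
  shorter by a factor of at least \<open>q\<close> and the remainder has
  norm at most \<open>q r\<close>, so the short vectors generate \<open>L\<close> by induction on the norm.
\<close>

lemma lattice_in_span_short_vectors:
  fixes L :: "('a::{field,finite} fls ^ 'n) set"
  assumes L: "poly_submodule L" and cover: "covers_by_balls L r" and "r > 0"
  shows "L \<subseteq> vec.span {v \<in> L. vec_norm v \<le> real CARD('a) * r}"
proof
  let ?q = "real CARD('a)" and ?W = "vec.span {v \<in> L. vec_norm v \<le> real CARD('a) * r}"
  have q: "?q > 1" using card_field_gt_1[where 'a = 'a] by simp
  have *: "v \<in> ?W" if "v \<in> L" "vec_norm v \<le> ?q ^ Suc k * r" for k v
    using that
  proof (induction k arbitrary: v)
    case 0
    thus ?case by (intro vec.span_base) auto
  next
    case (Suc k)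
    let ?x = "fls_X_inv :: 'a fls"
    \<comment> \<open>\<open>v = x u + x (v/x - u)\<close>, where \<open>u\<close> falls under the induction hypothesis and the second
      summand is a short vector of \<open>L\<close>.\<close>
    obtain u where u: "u \<in> L" "vec_norm (inverse ?x *s v - u) \<le> r"
      using cover unfolding covers_by_balls_def by blast
    have scale: "vec_norm (?x *s w) = ?q * vec_norm w" for w :: "'a fls ^ 'n"
      by (simp add: vec_norm_scale laurent_abs_X_inv)
    have xv: "?x *s (inverse ?x *s v) = v"
      by simp
    have "vec_norm v = ?q * vec_norm (inverse ?x *s v)"
      using scale[of "inverse ?x *s v"] by (simp only: xv)
    hence "vec_norm (inverse ?x *s v) \<le> ?q ^ Suc k * r"
      using Suc.prems(2) q by simp
    moreover have "vec_norm (inverse ?x *s v - u) \<le> ?q ^ Suc k * r"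
      using u(2) q \<open>r > 0\<close> one_le_power[of ?q "Suc k"] mult_right_mono[of 1 "?q ^ Suc k" r] by linarith
    ultimately have "vec_norm (inverse ?x *s v - (inverse ?x *s v - u)) \<le> ?q ^ Suc k * r"
      by (rule vec_norm_diff)
    hence "u \<in> ?W" using u(1) by (intro Suc.IH) simp_all
    moreover have "v - ?x *s u \<in> ?W"
    proof (intro vec.span_base CollectI conjI)
      have "?x *s u \<in> L"
        using L u(1) poly_to_laurent_X unfolding poly_submodule_def by metis
      thus "v - ?x *s u \<in> L" using Suc.prems(1) by (intro poly_submodule_diff[OF L])
      have "v - ?x *s u = ?x *s (inverse ?x *s v - u)"
        by (simp only: vec.scale_right_diff_distrib xv)
      thus "vec_norm (v - ?x *s u) \<le> ?q * r" using u(2) q by (simp only: scale) simp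
    qed
    ultimately have "?x *s u + (v - ?x *s u) \<in> ?W"
      by (intro vec.span_add vec.span_scale)
    thus ?case by simp
  qed
  fix v assume "v \<in> L"
  obtain k where "vec_norm v / r < ?q ^ k" using real_arch_pow[OF q] by blast
  also have "\<dots> \<le> ?q ^ Suc k" using q by (intro power_increasing) auto
  finally have "vec_norm v \<le> ?q ^ Suc k * r" using \<open>r > 0\<close> by (simp add: field_simps)
  thus "v \<in> ?W" using \<open>v \<in> L\<close> by (intro *)
qed

lemma short_basis_if_cover:
  fixes L :: "('a::{field,finite} fls ^ 'n) set"
  assumes "poly_submodule L" "vec.span L = UNIV" "covers_by_balls L r" "r > 0"
  shows "has_short_basis L (real CARD('a) * r)"
proof -
  let ?V = "{v \<in> L. vec_norm v \<le> real CARD('a) * r}"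
  have span: "vec.span ?V = UNIV"
    using vec.span_minimal[OF lattice_in_span_short_vectors vec.subspace_span] assms by blast
  obtain S where "S \<subseteq> ?V" "finite S" "card S = CARD('n)" "vec.independent S"
    using spanning_set_contains_basis[OF span] by blast
  thus ?thesis unfolding has_short_basis_def by (intro exI[of _ S]) auto
qed

section \<open>The least bound\<close>

lemma matrix_inv_both:
  fixes A :: "'a::field ^ 'n ^ 'n"
  assumes "invertible A"
  shows "matrix_inv A ** A = mat 1" "A ** matrix_inv A = mat 1"
  using someI_ex[OF assms[unfolded invertible_def]] by (simp_all add: matrix_inv_def)

text \<open>
  The bounds that occur can be lowered to powers \<open>q\<^sup>k\<close> with \<open>k\<close> bounded below, and a nonempty set of
  integers that is bounded below has a least element. The lower bound comes from discreteness: a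
  nonzero \<open>v = A p\<close> with \<open>p\<close> polynomial satisfies \<open>1 \<le> \<parallel>p\<parallel> = \<parallel>A\<^sup>-\<^sup>1 v\<parallel> \<le> b \<parallel>v\<parallel>\<close>.
\<close>

lemma least_short_basis_bound:
  fixes A :: "'a::{field,finite} fls ^ 'n ^ 'n"
  assumes "invertible A"
  defines "L \<equiv> (*v) A ` poly_vectors"
  obtains s where "s > 0" "has_short_basis L s" "\<And>t. has_short_basis L t \<Longrightarrow> s \<le> t"
proof -
  let ?q = "real CARD('a)"
  have q: "?q > 1" using card_field_gt_1[where 'a = 'a] by simp
  obtain b where b: "b > 0" "\<And>v. vec_norm (matrix_inv A *v v) \<le> b * vec_norm v"
    using vec_norm_matrix_bound[of "matrix_inv A"] by blast
  have discrete: "1 \<le> b * vec_norm v" if v: "v \<in> L" "v \<noteq> 0" for v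
  proof -
    obtain p where p: "p \<in> poly_vectors" "v = A *v p" using v by (auto simp: L_def)
    hence "p = matrix_inv A *v v"
      by (simp add: matrix_vector_mul_assoc matrix_inv_both(1)[OF assms(1)])
    moreover have "p \<noteq> 0" using p v by auto
    ultimately show ?thesis
      using vec_norm_poly_vectors_ge_1[OF p(1)] b(2)[of v] by simp
  qed
  have lower: "\<exists>k. has_short_basis L (?q powi k) \<and> 1 / b \<le> ?q powi k \<and> ?q powi k \<le> t"
    if t: "has_short_basis L t" for t
  proof -
    obtain S where S: "S \<subseteq> L" "finite S" "card S = CARD('n)" "vec.independent S"
      "\<forall>v\<in>S. vec_norm v \<le> t"
      using t by (auto simp: has_short_basis_def)
    have ne: "S \<noteq> {}" using S(3) by auto
    \<comment> \<open>The largest norm in \<open>S\<close> is the power of \<open>q\<close> to which the bound \<open>t\<close> can be lowered.\<close>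
    have "Max (vec_norm ` S) \<in> vec_norm ` S" using S(2) ne by (intro Max_in) auto
    then obtain v where v: "v \<in> S" "Max (vec_norm ` S) = vec_norm v" by auto
    have v0: "v \<noteq> 0" using v(1) S(4) vec.dependent_zero by blast
    obtain k where k: "vec_norm v = ?q powi k" using vec_norm_eq_powi[OF v0] by blast
    have "vec_norm w \<le> ?q powi k" if "w \<in> S" for w
      using Max_ge[of "vec_norm ` S" "vec_norm w"] S(2) that v(2) k by simp
    hence "has_short_basis L (?q powi k)" using S unfolding has_short_basis_def by blast
    moreover have "1 / b \<le> ?q powi k"
      using discrete[of v] v(1) v0 S(1) b(1) by (auto simp: k[symmetric] field_simps)
    moreover have "?q powi k \<le> t" using S(5) v(1) k by metis
    ultimately show ?thesis by blast
  qed
  obtain N where N: "b < ?q ^ N" using real_arch_pow[OF q] by blast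
  define K where "K = {k. has_short_basis L (?q powi k) \<and> 1 / b \<le> ?q powi k}"
  have bound: "- int N \<le> k" if "k \<in> K" for k
  proof (rule ccontr)
    assume "\<not> - int N \<le> k"
    hence "?q powi k \<le> ?q powi (- int N)" using q by (intro power_int_increasing) auto
    also have "\<dots> = 1 / ?q ^ N" by (simp add: power_int_minus field_simps)
    also have "\<dots> < 1 / b" using N b(1) by (intro divide_strict_left_mono) auto
    finally show False using that by (auto simp: K_def)
  qed
  have "has_short_basis L (Max (vec_norm ` S))"
    if "S \<subseteq> L" "finite S" "card S = CARD('n)" "vec.independent S" for S
    using that unfolding has_short_basis_def by (intro exI[of _ S]) auto
  moreover obtain S where "S \<subseteq> L" "finite S" "card S = CARD('n)" "vec.independent S"
    using spanning_set_contains_basis[OF span_lattice[OF assms(1)]] unfolding L_def by blast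
  ultimately have "\<exists>t. has_short_basis L t" by blast
  then obtain k0 where k0: "k0 \<in> K" using lower by (auto simp: K_def)
  \<comment> \<open>Adding \<open>N\<close> makes all exponents in \<open>K\<close> nonnegative, so that minimisation takes place in \<open>nat\<close>.\<close>
  define m where "m = (ARG_MIN (\<lambda>k. nat (k + int N)) k. k \<in> K)"
  have m: "m \<in> K" "\<And>k. k \<in> K \<Longrightarrow> m \<le> k"
  proof -
    show "m \<in> K" unfolding m_def by (rule arg_min_natI) (rule k0)
    fix k assume k: "k \<in> K"
    hence "nat (m + int N) \<le> nat (k + int N)" unfolding m_def by (rule arg_min_nat_le)
    thus "m \<le> k" using bound[OF k] by linarith
  qed
  show ?thesis
  proof (rule that[of "?q powi m"])
    show "?q powi m > 0" using q by simp
    show "has_short_basis L (?q powi m)" using m(1) by (simp add: K_def)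
    fix t assume "has_short_basis L t"
    then obtain k where k: "k \<in> K" "?q powi k \<le> t" using lower by (auto simp: K_def)
    have "?q powi m \<le> ?q powi k" using q m(2)[OF k(1)] by (intro power_int_increasing) auto
    thus "?q powi m \<le> t" using k(2) by linarith
  qed
qed

section \<open>The covering radius of a convex body\<close>

lemma covers_iff_covers_by_balls:
  fixes h :: "'a::{field,finite} fls ^ 'n ^ 'n" and \<Lambda> :: "('a fls ^ 'n) set"
  assumes h: "invertible h"
  shows "{u + v | u v. u \<in> \<Lambda> \<and> v \<in> dilate r ((*v) h ` integral_vectors)} = UNIV \<longleftrightarrow>
           covers_by_balls ((*v) (matrix_inv h) ` \<Lambda>) r"
proof -
  have inv: "matrix_inv h *v (h *v v) = v" "h *v (matrix_inv h *v v) = v" for v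
    by (simp_all add: matrix_vector_mul_assoc matrix_inv_both(1)[OF h] matrix_inv_both(2)[OF h])
  have "(\<exists>u v. h *v y = u + v \<and> u \<in> \<Lambda> \<and> v \<in> (*v) h ` {w. vec_norm w \<le> r}) \<longleftrightarrow>
        (\<exists>u\<in>\<Lambda>. vec_norm (y - matrix_inv h *v u) \<le> r)" for y
  proof safe
    fix u w assume eq: "h *v y = u + h *v w" and *: "u \<in> \<Lambda>" "vec_norm w \<le> r"
    have "y = matrix_inv h *v u + w"
      using arg_cong[OF eq, of "(*v) (matrix_inv h)"] by (simp add: inv vec.add)
    thus "\<exists>u\<in>\<Lambda>. vec_norm (y - matrix_inv h *v u) \<le> r" using * by (intro bexI[of _ u]) auto
  next
    fix u assume *: "u \<in> \<Lambda>" "vec_norm (y - matrix_inv h *v u) \<le> r"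
    have "h *v y = u + h *v (y - matrix_inv h *v u)"
      by (simp add: inv vec.diff)
    thus "\<exists>u v. h *v y = u + v \<and> u \<in> \<Lambda> \<and> v \<in> (*v) h ` {w. vec_norm w \<le> r}"
      using * by blast
  qed
  note image = this
  have "(\<forall>z. \<exists>u v. z = u + v \<and> u \<in> \<Lambda> \<and> v \<in> (*v) h ` {w. vec_norm w \<le> r}) \<longleftrightarrow>
        (\<forall>y. \<exists>u v. h *v y = u + v \<and> u \<in> \<Lambda> \<and> v \<in> (*v) h ` {w. vec_norm w \<le> r})"
    (is "(\<forall>z. ?P z) \<longleftrightarrow> _")
  proof safe
    fix z assume "\<forall>y. ?P (h *v y)"
    hence "?P (h *v (matrix_inv h *v z))" by blast
    thus "?P z" by (simp only: inv)
  qed blast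
  thus ?thesis
    unfolding dilate_eq[OF h] covers_by_balls_def set_eq_iff image by simp
qed

theorem corollary1p26:
  fixes g h :: "'a::{field,finite} fls ^ 'n ^ 'n"
    and C \<Lambda> :: "('a fls ^ 'n) set"
  assumes "CARD('n) \<ge> 2"
    and "invertible h" and "C = (*v) h ` integral_vectors"
    and "invertible g" and "\<Lambda> = (*v) g ` poly_vectors"
  shows "covering_radius C \<Lambda> =
           1 / real CARD('a) * successive_minimum CARD('n) ((*v) (matrix_inv h) ` \<Lambda>) \<and>
         1 / real CARD('a) * successive_minimum CARD('n) ((*v) (matrix_inv h) ` \<Lambda>) =
           1 / real CARD('a) * successive_minimum CARD('n) ((*v) (matrix_inv h ** g) ` poly_vectors)"
proof -
  let ?q = "real CARD('a)"
  define L where "L = (*v) (matrix_inv h ** g) ` poly_vectors"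
  have L: "(*v) (matrix_inv h) ` \<Lambda> = L"
    by (simp add: L_def assms(5) image_image matrix_vector_mul_assoc)
  have "invertible (matrix_inv h)"
    unfolding invertible_def using matrix_inv_both(1)[OF assms(2)] matrix_inv_both(2)[OF assms(2)] by blast
  hence inv: "invertible (matrix_inv h ** g)" using assms(4) by (rule invertible_mult)
  have sub: "poly_submodule L" and span: "vec.span L = UNIV"
    unfolding L_def using inv by (simp_all add: poly_submodule_lattice span_lattice)
  obtain s where s: "s > 0" "has_short_basis L s" "\<And>t. has_short_basis L t \<Longrightarrow> s \<le> t"
    using least_short_basis_bound[OF inv] unfolding L_def by blast
  have cover_iff: "covers_by_balls L r \<longleftrightarrow> has_short_basis L (?q * r)" if "r > 0" for r
    using that cover_if_short_basis[OF sub] short_basis_if_cover[OF sub span] by force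
  have "successive_minimum CARD('n) L = s"
    unfolding successive_minimum_def has_short_basis_def[symmetric]
    using s by (intro Least_equality) auto
  moreover have "covering_radius C \<Lambda> = s / ?q"
    unfolding covering_radius_def assms(3) covers_iff_covers_by_balls[OF assms(2)] L
  proof (rule Least_equality)
    show "0 < s / ?q \<and> covers_by_balls L (s / ?q)"
      using s(1,2) by (simp add: cover_iff)
    fix r assume "0 < r \<and> covers_by_balls L r"
    hence "s \<le> ?q * r" using s(3) cover_iff by blast
    thus "s / ?q \<le> r" by (simp add: field_simps)
  qed
  ultimately show ?thesis unfolding L by (simp add: L_def)
qed

end
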